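(* Fix $k\in\mathbb{N}$ and $\mathbf{b}=\left(\frac{b_1}{a_1},\frac{b_2}{a_2},\ldots,\frac{b_k}{a_k}\right)\in\mathbb{Q}_{>0}^k$, where $a_1,\ldots,a_k\in\mathbb{N}$ and $b_1,\ldots,b_k\in\mathbb{N}$, and suppose that $\gcd\left(\frac{b_1}{a_1},\ldots,\frac{b_k}{a_k}\right)=1$, meaning that there are integers $m_1,\ldots,m_k$ with $\sum_{i=1}^k m_i\frac{b_i}{a_i}=1$. Let $\alpha=\operatorname{lcm}(a_1,\ldots,a_k)$. Then the proportion of points in $\mathbb{N}_{\frac{\alpha}{a_1}}\times\cdots\times\mathbb{N}_{\frac{\alpha}{a_k}}$ that are $\mathbf{b}$-visible is $\dfrac{1}{\zeta\left(\sum_{i=1}^k b_i\right)}$.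
   Context: $\mathbb{N}=\{1,2,3,\ldots\}$, and $\zeta(s)=\sum_{n=1}^{\infty}\frac{1}{n^{s}}$ is the Riemann zeta function. For $c\in\mathbb{N}$, $\mathbb{N}_c=\{\ell^c:\ell\in\mathbb{N}\}$. For $\mathbf{b}=\left(\frac{b_1}{a_1},\ldots,\frac{b_k}{a_k}\right)\in\mathbb{Q}_{>0}^k$, a lattice point $\mathbf{n}=(n_1,\ldots,n_k)\in\mathbb{N}^k$ is called $\mathbf{b}$-visible if there does not exist a real number $t$ with $0<t<1$ such that $\left(n_1t^{b_1/a_1},\ldots,n_kt^{b_k/a_k}\right)\in\mathbb{N}^k$ (powers are positive real powers). The proportion of points of $S=\mathbb{N}_{\frac{\alpha}{a_1}}\times\cdots\times\mathbb{N}_{\frac{\alpha}{a_k}}$ that are $\mathbf{b}$-visible means the limit as $N\to\infty$ of $\#\{\mathbf{n}\in S\cap\{1,\ldots,N\}^k:\mathbf{n}\text{ is }\mathbf{b}\text{-visible}\}$ divided by $\#\left(S\cap\{1,\ldots,N\}^k\right)$.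
   Formalization: Each fraction b_i/a_i is assumed to be in lowest terms, i.e. gcd(a_i, b_i) = 1; without this the claim fails, e.g. for k = 1 and a_1 = b_1 = 2, where only the point 1 is visible and the proportion is 0 instead of 1/ζ(2). *)

theory Defs
  imports "HOL-Analysis.Analysis"
begin

text \<open>
  Points of $\mathbb{N}^k$ are functions in \<^term>\<open>{1..k} \<rightarrow>\<^sub>E {1..}\<close>, i.e. functions
  that are \<^term>\<open>undefined\<close> outside the index set, so that distinct functions are distinct points.
\<close>

definition nth_powers :: "nat \<Rightarrow> nat set" where
  "nth_powers c = {l ^ c | l. l \<ge> 1}"

definition visible :: "nat \<Rightarrow> (nat \<Rightarrow> rat) \<Rightarrow> (nat \<Rightarrow> nat) \<Rightarrow> bool" where
  "visible k \<beta> n \<longleftrightarrow>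
     \<not> (\<exists>t::real. 0 < t \<and> t < 1 \<and>
          (\<forall>i\<in>{1..k}. real (n i) * t powr real_of_rat (\<beta> i) \<in> \<nat> - {0}))"

definition has_proportion ::
  "nat \<Rightarrow> (nat \<Rightarrow> nat) set \<Rightarrow> ((nat \<Rightarrow> nat) \<Rightarrow> bool) \<Rightarrow> real \<Rightarrow> bool" where
  "has_proportion k S P p \<longleftrightarrow>
     (\<lambda>N::nat. real (card {n \<in> S \<inter> ({1..k} \<rightarrow>\<^sub>E {1..N}). P n}) /
               real (card (S \<inter> ({1..k} \<rightarrow>\<^sub>E {1..N})))) \<longlonglongrightarrow> p"

text \<open>
  The series is summed in \<^typ>\<open>ennreal\<close>, so that \<open>zeta 1\<close> is \<open>\<infinity>\<close> and
  \<open>1 / zeta 1\<close> is \<open>0\<close>; a real-valued \<^const>\<open>suminf\<close> would be unspecified there.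
\<close>

definition zeta :: "real \<Rightarrow> ennreal" where
  "zeta s = (\<Sum>n. ennreal (1 / real (Suc n) powr s))"

lemma zeta_eq_real_series:
  assumes "s > 1"
  shows "zeta s = ennreal (\<Sum>n. 1 / real (Suc n) powr s)"
proof -
  have "summable (\<lambda>n. real n powr (- s))"
    using assms by (simp add: summable_real_powr_iff)
  then have "summable (\<lambda>n. real (Suc n) powr (- s))"
    by (subst summable_Suc_iff)
  then have "summable (\<lambda>n. 1 / real (Suc n) powr s)"
    by (simp add: powr_minus_divide)
  then show ?thesis
    unfolding zeta_def by (intro suminf_ennreal2) auto
qed

lemma zeta_1: "zeta 1 = \<infinity>"
proof (rule ccontr)
  assume "zeta 1 \<noteq> \<infinity>"
  then have "(\<Sum>n. ennreal (1 / real (Suc n))) \<noteq> top"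
    by (simp add: zeta_def)
  then have "summable (\<lambda>n. 1 / real (Suc n))"
    by (intro summable_suminf_not_top) auto
  then have "summable (\<lambda>n. inverse (real (Suc n)))"
    by (simp add: inverse_eq_divide)
  then have "summable (\<lambda>n. inverse (real n))"
    by (subst (asm) summable_Suc_iff)
  then show False
    using not_summable_harmonic[where 'a=real] by simp
qed

end

theory Submission
  imports Defs "HOL-Computational_Algebra.Squarefree" "HOL-Computational_Algebra.Nth_Powers"
begin

text \<open>
  Write $n_i = l_i^{\alpha/a_i}$. If $t$ witnesses that $n$ is not visible, then the exponents $e$
  with $t^e$ rational form a group containing all $b_i/a_i$, hence $1$ by the gcd hypothesis, hence
  all $1/a_i$ by coprimality, hence $1/\alpha$. In lowest terms $t^{1/\alpha} = p/q$ with $q > 1$,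
  and integrality forces $q^{b_i} \mid l_i$ for all $i$; conversely such a $q$ gives the witness
  $t = q^{-\alpha}$. So visible points correspond to tuples $l$ without a common divisor
  of this kind, and these are counted by Moebius inversion, with Tannery's theorem justifying
  the passage to the limit termwise. Only $k = 1$, $b_1 = 1$, where the zeta series diverges,
  needs a separate count.
\<close>

section \<open>The Moebius function and its divisor sums\<close>

definition moebius_mu :: "nat \<Rightarrow> real" where
  "moebius_mu d = (if squarefree d then (- 1) ^ card (prime_factors d) else 0)"

lemma abs_moebius_le: "\<bar>moebius_mu d\<bar> \<le> 1"
  by (simp add: moebius_mu_def)

text \<open>A new prime factor preserves squarefreeness and changes the parity of the number of
  primes; if d is not squarefree, neither is its multiple, and both sides vanish.\<close>

lemma moebius_prime_mult:
  assumes "prime p" "\<not> p dvd d"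
  shows "moebius_mu (p * d) = - moebius_mu d"
proof (cases "squarefree d")
  case True
  have "coprime p d"
    using assms by (simp add: prime_imp_coprime)
  then have "squarefree (p * d)"
    using True assms(1) by (intro squarefree_mult_coprime) (auto intro: squarefree_prime)
  moreover have "prime_factors (p * d) = insert p (prime_factors d)"
    using assms by (subst prime_factors_product) (auto simp: prime_prime_factors intro!: gr0I)
  moreover have "p \<notin> prime_factors d"
    using assms by auto
  ultimately show ?thesis
    using True by (simp add: moebius_mu_def)
next
  case False
  then have "\<not> squarefree (p * d)"
    using squarefree_multD(2) by blast
  with False show ?thesis
    by (simp add: moebius_mu_def)
qed

text \<open>For n > 1 fix a prime p dividing n. Multiplication by p pairs the squarefree divisors
  prime to p with those divisible by p, and the two members of a pair have opposite signs.\<close>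

lemma sum_moebius_divisors:
  assumes "n \<ge> 1"
  shows "(\<Sum>d | d dvd n. moebius_mu d) = (if n = 1 then 1 else 0)"
proof (cases "n = 1")
  case True
  then show ?thesis
    by (simp add: moebius_mu_def)
next
  case False
  then obtain p where p: "prime p" "p dvd n"
    using prime_factor_nat by blast
  let ?D = "{d. d dvd n \<and> squarefree d}"
  have fin: "finite {d. d dvd n}"
    using assms by simp
  then have finD: "finite ?D"
    by (rule rev_finite_subset) auto
  have bij: "bij_betw ((*) p) (?D \<inter> {d. \<not> p dvd d}) (?D \<inter> {d. p dvd d})"
  proof (rule bij_betwI')
    show "(p * x = p * y) \<longleftrightarrow> x = y" for x y
      using p by auto
    show "p * x \<in> ?D \<inter> {d. p dvd d}" if "x \<in> ?D \<inter> {d. \<not> p dvd d}" for x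
    proof -
      have "coprime p x"
        using that p by (simp add: prime_imp_coprime)
      then show ?thesis
        using that p squarefree_mult_coprime[of p x] squarefree_prime[of p] divides_mult[of p n x]
        by auto
    qed
    show "\<exists>x\<in>?D \<inter> {d. \<not> p dvd d}. y = p * x" if y: "y \<in> ?D \<inter> {d. p dvd d}" for y
    proof -
      obtain x where x: "y = p * x"
        using y by auto
      \<comment> \<open>Otherwise p^2 would divide the squarefree number y.\<close>
      moreover have "\<not> p dvd x"
        using y p x squarefreeD[of y p] by (simp add: power2_eq_square) (use not_prime_unit in blast)
      moreover have "x dvd n" "squarefree x"
        using y x squarefree_multD(2) dvd_mult_right by auto
      ultimately show ?thesis
        by blast
    qed
  qed
  have "(\<Sum>d | d dvd n. moebius_mu d) = (\<Sum>d\<in>?D. moebius_mu d)"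
    using fin by (intro sum.mono_neutral_right) (auto simp: moebius_mu_def)
  also have "\<dots> = (\<Sum>d\<in>?D \<inter> {d. p dvd d}. moebius_mu d) + (\<Sum>d\<in>?D \<inter> {d. \<not> p dvd d}. moebius_mu d)"
    using finD by (subst sum.union_disjoint[symmetric]) (auto intro: sum.cong)
  also have "(\<Sum>d\<in>?D \<inter> {d. p dvd d}. moebius_mu d) = (\<Sum>d\<in>?D \<inter> {d. \<not> p dvd d}. moebius_mu (p * d))"
    by (rule sum.reindex_bij_betw[OF bij, symmetric])
  also have "\<dots> = (\<Sum>d\<in>?D \<inter> {d. \<not> p dvd d}. - moebius_mu d)"
    using p by (intro sum.cong) (auto simp: moebius_prime_mult)
  finally show ?thesis
    using False by (simp add: sum_negf)
qed

section \<open>Common power divisors of a tuple\<close>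

lemma lcm_power_distrib_nat:
  fixes x y :: nat
  shows "lcm (x ^ n) (y ^ n) = lcm x y ^ n"
proof (cases "x = 0 \<or> y = 0")
  case True
  then show ?thesis
    by (cases n) auto
next
  case False
  have "gcd x y ^ n * lcm x y ^ n = (x * y) ^ n"
    by (simp flip: power_mult_distrib)
  also have "\<dots> = gcd (x ^ n) (y ^ n) * lcm (x ^ n) (y ^ n)"
    by (simp only: prod_gcd_lcm_nat[of "x ^ n" "y ^ n", symmetric] power_mult_distrib)
  finally show ?thesis
    using False by simp
qed

lemma dvd_if_power_dvd:
  fixes d m n :: nat
  assumes "d ^ n dvd m" "n \<ge> 1"
  shows "d dvd m"
  using assms(2) by (intro dvd_trans[OF _ assms(1)] dvd_power) simp

text \<open>The set of common power divisors is closed under lcm, hence consists of all divisors of its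
  maximum.\<close>
lemma sum_moebius_power_divisors:
  assumes "I \<noteq> {}" "\<And>i. i \<in> I \<Longrightarrow> b i \<ge> (1::nat)" "\<And>i. i \<in> I \<Longrightarrow> l i \<ge> (1::nat)"
  shows "(\<Sum>d | \<forall>i\<in>I. d ^ b i dvd l i. moebius_mu d) =
           (if \<forall>d. (\<forall>i\<in>I. d ^ b i dvd l i) \<longrightarrow> d = 1 then 1 else 0)"
proof -
  let ?D = "{d. \<forall>i\<in>I. d ^ b i dvd l i}"
  obtain j where j: "j \<in> I"
    using assms(1) by auto
  have "d \<le> l j" if "d \<in> ?D" for d
  proof -
    have "d dvd l j"
      using that j assms(2)[OF j] dvd_if_power_dvd by blast
    then show ?thesis
      using assms(3)[OF j] by (intro dvd_imp_le) auto
  qed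
  then have fin: "finite ?D"
    by (intro finite_subset[of ?D "{..l j}"]) (blast | simp)+
  have one: "1 \<in> ?D"
    by (intro CollectI ballI) (simp only: power_one one_dvd)
  then have ne: "?D \<noteq> {}"
    by (metis empty_iff)
  define g where "g = Max ?D"
  have g: "g \<in> ?D"
    unfolding g_def by (rule Max_in[OF fin ne])
  have g1: "g \<ge> 1"
    unfolding g_def by (rule Max_ge[OF fin one])
  have "d dvd g" if "d \<in> ?D" for d
  proof -
    have "lcm d g \<in> ?D"
      using that g by (auto simp flip: lcm_power_distrib_nat)
    then have "lcm d g \<le> g"
      unfolding g_def by (rule Max_ge[OF fin])
    \<comment> \<open>The lcm is positive because d is: d = 0 would give \<open>0 ^ b j = 0\<close>
      as a divisor of \<open>l j \<ge> 1\<close>. Positivity turns the divisibility into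
      \<open>g \<le> lcm d g\<close>.\<close>
    moreover have "g dvd lcm d g" "lcm d g > 0"
      using that g1 assms(2,3)[OF j] j by (auto intro!: gr0I simp: power_0_left)
    ultimately have "lcm d g = g"
      by (meson dvd_imp_le le_antisym)
    then show ?thesis
      by (metis dvd_lcm1)
  qed
  moreover have "d \<in> ?D" if "d dvd g" for d
    using g dvd_trans[OF dvd_power_same[OF that]] by blast
  ultimately have D: "?D = {d. d dvd g}"
    by blast
  have "(\<forall>d. (\<forall>i\<in>I. d ^ b i dvd l i) \<longrightarrow> d = 1) \<longleftrightarrow> (\<forall>d\<in>?D. d = 1)"
    by simp
  also have "\<dots> \<longleftrightarrow> g = 1"
  proof
    assume "\<forall>d\<in>?D. d = 1"
    then show "g = 1"
      using g by (rule bspec)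
  next
    assume "g = 1"
    then show "\<forall>d\<in>?D. d = 1"
      unfolding D by simp
  qed
  finally show ?thesis
    unfolding D using sum_moebius_divisors[OF g1] by simp
qed

section \<open>Counting points of a box by Moebius inversion\<close>

lemma card_multiples:
  fixes n e :: nat
  assumes "e \<ge> 1"
  shows "card {x \<in> {1..n}. e dvd x} = n div e"
proof -
  have "{x \<in> {1..n}. e dvd x} = (*) e ` {1..n div e}"
    using assms by (auto simp: less_eq_div_iff_mult_less_eq mult.commute elim!: dvdE)
  moreover have "inj_on ((*) e) {1..n div e}"
    using assms by (auto intro: inj_onI)
  ultimately show ?thesis
    by (simp add: card_image)
qed

lemma card_box_multiples:
  fixes X e :: "'a \<Rightarrow> nat"
  assumes "finite I" "\<And>i. i \<in> I \<Longrightarrow> e i \<ge> 1"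
  shows "card {l \<in> (\<Pi>\<^sub>E i\<in>I. {1..X i}). \<forall>i\<in>I. e i dvd l i} = (\<Prod>i\<in>I. X i div e i)"
proof -
  have "{l \<in> (\<Pi>\<^sub>E i\<in>I. {1..X i}). \<forall>i\<in>I. e i dvd l i} = (\<Pi>\<^sub>E i\<in>I. {x \<in> {1..X i}. e i dvd x})"
    by (auto simp: PiE_iff extensional_def)
  then show ?thesis
    using assms by (simp add: card_PiE card_multiples del: atLeastAtMost_iff One_nat_def)
qed

text \<open>The indicator of power-free tuples is a Moebius sum over common power divisors;
  exchanging the summations leaves counts of multiples in the box. The finite sum is stated as an
  infinite series, its terms vanishing from \<open>X j\<close> on, so that its range does not vary
  with the box when limits are taken.\<close>

lemma card_power_free_box:
  fixes X b :: "'a \<Rightarrow> nat"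
  assumes "finite I" "I \<noteq> {}" "\<And>i. i \<in> I \<Longrightarrow> b i \<ge> 1"
  shows "(\<lambda>d. moebius_mu (Suc d) * real (\<Prod>i\<in>I. X i div Suc d ^ b i)) sums
           real (card {l \<in> (\<Pi>\<^sub>E i\<in>I. {1..X i}). \<forall>d. (\<forall>i\<in>I. d ^ b i dvd l i) \<longrightarrow> d = 1})"
proof -
  obtain j where j: "j \<in> I"
    using assms(2) by auto
  let ?B = "\<Pi>\<^sub>E i\<in>I. {1..X i}"
  let ?Q = "\<lambda>d l. \<forall>i\<in>I. d ^ b i dvd l i"
  have finB: "finite ?B"
    using assms(1) by (intro finite_PiE) auto
  \<comment> \<open>A range for d that is independent of l, which allows the two sums to be
    exchanged.\<close>
  have Qle: "d \<in> {1..X j}" if "l \<in> ?B" "?Q d l" for d l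
  proof -
    have "1 \<le> l j" "l j \<le> X j"
      using that(1) j by (auto simp: PiE_iff extensional_def)
    moreover have "d dvd l j"
      using that(2) j assms(3)[OF j] dvd_if_power_dvd by blast
    ultimately show ?thesis
      using dvd_imp_le[of d "l j"] by (auto intro!: Suc_leI gr0I)
  qed
  have "real (card {l \<in> ?B. \<forall>d. ?Q d l \<longrightarrow> d = 1}) =
          (\<Sum>l\<in>?B. if \<forall>d. ?Q d l \<longrightarrow> d = 1 then 1 else 0)"
    using finB by (subst sum.inter_filter[symmetric]) auto
  also have "\<dots> = (\<Sum>l\<in>?B. \<Sum>d | ?Q d l. moebius_mu d)"
    using assms by (intro sum.cong refl sum_moebius_power_divisors[symmetric]) (auto simp: PiE_iff)
  also have "\<dots> = (\<Sum>l\<in>?B. \<Sum>d | d \<in> {1..X j} \<and> ?Q d l. moebius_mu d)"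
    using Qle by (intro sum.cong refl) blast
  also have "\<dots> = (\<Sum>d\<in>{1..X j}. \<Sum>l | l \<in> ?B \<and> ?Q d l. moebius_mu d)"
    using finB by (intro sum.swap_restrict) auto
  also have "\<dots> = (\<Sum>d\<in>{1..X j}. moebius_mu d * real (\<Prod>i\<in>I. X i div d ^ b i))"
  proof (intro sum.cong refl)
    fix d assume "d \<in> {1..X j}"
    then have "card {l \<in> ?B. ?Q d l} = (\<Prod>i\<in>I. X i div d ^ b i)"
      using assms by (intro card_box_multiples) auto
    then show "(\<Sum>l | l \<in> ?B \<and> ?Q d l. moebius_mu d) = moebius_mu d * real (\<Prod>i\<in>I. X i div d ^ b i)"
      by (simp add: mult.commute)
  qed
  \<comment> \<open>Divisors start at 1 and series indices at 0, hence the shift by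
    \<open>Suc\<close>.\<close>
  also have "\<dots> = (\<Sum>d\<in>{..<X j}. moebius_mu (Suc d) * real (\<Prod>i\<in>I. X i div Suc d ^ b i))"
    by (intro sum.reindex_bij_witness[of _ Suc "\<lambda>d. d - 1"]) auto
  finally have eq: "real (card {l \<in> ?B. \<forall>d. ?Q d l \<longrightarrow> d = 1}) = \<dots>" .
  show ?thesis
    unfolding eq
  proof (rule sums_finite)
    fix d assume "d \<notin> {..<X j}"
    then have "X j < Suc d"
      by simp
    also have "Suc d ^ 1 \<le> Suc d ^ b j"
      using assms(3)[OF j] by (intro power_increasing) auto
    finally have "X j div Suc d ^ b j = 0"
      by simp
    then have "(\<Prod>i\<in>I. X i div Suc d ^ b i) = 0"
      using j assms(1) by (meson prod_zero)
    then show "moebius_mu (Suc d) * real (\<Prod>i\<in>I. X i div Suc d ^ b i) = 0"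
      by simp
  qed auto
qed

section \<open>The Moebius series as the reciprocal of zeta\<close>

text \<open>Absolute convergence makes the series an unordered sum over the positive integers, the
  setting in which a double sum may be rearranged.\<close>

lemma has_sum_shifted_series:
  fixes f :: "nat \<Rightarrow> real"
  assumes "summable (\<lambda>n. \<bar>f (Suc n)\<bar>)"
  shows "(f has_sum (\<Sum>n. f (Suc n))) {1..}"
proof -
  have "((\<lambda>n. f (Suc n)) has_sum (\<Sum>n. f (Suc n))) UNIV"
    using assms summable_rabs_cancel[OF assms]
    by (intro norm_summable_imp_has_sum summable_sums) simp_all
  then show ?thesis
    by (subst has_sum_reindex_bij_witness[of _ Suc "\<lambda>n. n - 1" UNIV "\<lambda>n. f (Suc n)", OF _ _ _ _ _ refl]) auto
qed

lemma summable_inverse_Suc_power: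
  assumes "s \<ge> 2"
  shows "summable (\<lambda>n. 1 / real (Suc n) ^ s)"
  using inverse_power_summable[OF assms, where 'a = real]
  by (subst (asm) summable_Suc_iff[symmetric]) (simp add: inverse_eq_divide)

lemma summable_abs_moebius_mu_series:
  assumes "s \<ge> 2"
  shows "summable (\<lambda>n. \<bar>moebius_mu (Suc n) / real (Suc n) ^ s\<bar>)"
  using summable_inverse_Suc_power[OF assms]
  by (rule summable_comparison_test'[where N = 0])
    (simp add: abs_moebius_le divide_right_mono abs_divide)

text \<open>Dirichlet convolution with the constant 1 collapses the double series to its first term.\<close>
lemma moebius_mu_series_times_zeta:
  assumes "s \<ge> 2"
  shows "(\<Sum>n. moebius_mu (Suc n) / real (Suc n) ^ s) * (\<Sum>n. 1 / real (Suc n) ^ s) = 1"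
proof -
  define m where "m n = moebius_mu n / real n ^ s" for n
  define g where "g n = 1 / real n ^ s" for n
  define M where "M = (\<Sum>n. m (Suc n))"
  define Z where "Z = (\<Sum>n. g (Suc n))"
  have m: "(m has_sum M) {1..}"
    unfolding M_def using summable_abs_moebius_mu_series[OF assms]
    by (intro has_sum_shifted_series) (simp add: m_def)
  have g: "(g has_sum Z) {1..}"
    unfolding Z_def using summable_inverse_Suc_power[OF assms]
    by (intro has_sum_shifted_series) (simp add: g_def)
  \<comment> \<open>This nonnegative family majorizes the double series of \<open>m d * g e\<close>,
    because the Moebius function is at most 1 in absolute value.\<close>
  have "(\<lambda>(d, e). g d * g e) summable_on ({1..} \<times> {1..})"
  proof (rule summable_on_SigmaI)
    show "((\<lambda>e. case (d, e) of (d, e) \<Rightarrow> g d * g e) has_sum g d * Z) {1..}" for d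
      using has_sum_cmult_right[OF g, of "g d"] by simp
    show "(\<lambda>d. g d * Z) summable_on {1..}"
      using has_sum_imp_summable[OF has_sum_cmult_left[OF g, of Z]] .
  qed (auto simp: g_def)
  then have "(\<lambda>(d, e). m d * g e) summable_on ({1..} \<times> {1..})"
  proof (rule Infinite_Sum.abs_summable_summable[OF Infinite_Sum.abs_summable_on_comparison_test'])
    fix x :: "nat \<times> nat"
    show "norm (case x of (d, e) \<Rightarrow> m d * g e) \<le> (case x of (d, e) \<Rightarrow> g d * g e)"
      using abs_moebius_le by (cases x) (simp add: m_def g_def abs_mult divide_right_mono)
  qed
  then have "((\<lambda>(d, e). m d * g e) has_sum M * Z) ({1..} \<times> {1..})"
    using has_sum_cmult_right[OF g] has_sum_cmult_left[OF m, of Z]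
    by (intro has_sum_SigmaI[where g = "\<lambda>d. m d * Z"]) auto
  \<comment> \<open>Terms are regrouped by the product n = d * e; a pair (d, e) becomes n together
    with its divisor d.\<close>
  also have "((\<lambda>(d, e). m d * g e) has_sum M * Z) ({1..} \<times> {1..}) \<longleftrightarrow>
      ((\<lambda>(n, d). moebius_mu d / real n ^ s) has_sum M * Z) (Sigma {1..} (\<lambda>n. {d. d dvd n}))"
    by (rule has_sum_reindex_bij_witness[of _ "\<lambda>(n, d). (d, n div d)" "\<lambda>(d, e). (d * e, d)"])
      (auto simp: m_def g_def power_mult_distrib Suc_le_eq dvd_div_eq_0_iff intro!: gr0I)
  finally have "((\<lambda>n::nat. if n = 1 then 1 else 0) has_sum M * Z) {1..}"
  proof (rule has_sum_SigmaD)
    fix n :: nat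
    assume n: "n \<in> {1..}"
    have "(\<Sum>d | d dvd n. moebius_mu d / real n ^ s) = (if n = 1 then 1 else 0)"
      using sum_moebius_divisors[of n] n by (simp flip: sum_divide_distrib)
    moreover have "finite {d. d dvd n}"
      using n by simp
    ultimately show "((\<lambda>d. case (n, d) of (n, d) \<Rightarrow> moebius_mu d / real n ^ s) has_sum
        (if n = 1 then 1 else 0)) {d. d dvd n}"
      by (subst has_sum_finite_iff) simp_all
  qed
  moreover have "((\<lambda>n::nat. if n = 1 then 1 else 0) has_sum (1::real)) {1..}"
    by (rule has_sum_finite_neutralI[of "{1}"]) auto
  ultimately have "M * Z = 1"
    by (rule has_sum_unique)
  then show ?thesis
    by (simp add: M_def Z_def m_def g_def)
qed

section \<open>Density of power-free tuples in growing boxes\<close>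

lemma of_nat_div_eq_floor: "real (x div e) = of_int \<lfloor>real x / real e\<rfloor>"
  by (simp add: floor_divide_of_nat_eq)

text \<open>The dominating bound for Tannery's theorem. It covers x = 0 as well, where the quotient
  is 0 by convention, so empty boxes need no exception.\<close>

lemma div_over_le: "real (x div e) / real x \<le> 1 / real e"
proof -
  have "real (x div e) \<le> real x / real e"
    unfolding of_nat_div_eq_floor by linarith
  then have "real (x div e) / real x \<le> (real x / real e) / real x"
    by (intro divide_right_mono) simp_all
  also have "\<dots> \<le> 1 / real e"
    by (cases "x = 0") simp_all
  finally show ?thesis .
qed

lemma div_over_tendsto: "(\<lambda>x::nat. real (x div e) / real x) \<longlonglongrightarrow> 1 / real e"
proof (rule tendsto_sandwich)
  have "(\<lambda>x. 1 / real e - 1 / real x) \<longlonglongrightarrow> 1 / real e - 0"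
    by (intro tendsto_intros lim_1_over_n)
  then show "(\<lambda>x. 1 / real e - 1 / real x) \<longlonglongrightarrow> 1 / real e"
    by simp
  have "1 / real e - 1 / real x \<le> real (x div e) / real x" if "x \<ge> 1" for x
  proof -
    have "real x / real e - 1 \<le> real (x div e)"
      unfolding of_nat_div_eq_floor by linarith
    then have "(real x / real e - 1) / real x \<le> real (x div e) / real x"
      by (rule divide_right_mono) simp
    then show ?thesis
      using that by (simp add: diff_divide_distrib)
  qed
  then show "\<forall>\<^sub>F x in sequentially. 1 / real e - 1 / real x \<le> real (x div e) / real x"
    using eventually_sequentially by blast
  show "\<forall>\<^sub>F x in sequentially. real (x div e) / real x \<le> 1 / real e"
    by (intro always_eventually allI div_over_le)
qed simp

text \<open>After division by the size of the box, the term for d tends to its Moebius value over d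
  to the power \<open>sum b I\<close>, and it is dominated uniformly in N by the same power of 1/d,
  which is summable since the exponent is at least 2.\<close>

lemma density_power_free_box:
  fixes X :: "'a \<Rightarrow> nat \<Rightarrow> nat" and b :: "'a \<Rightarrow> nat"
  assumes "finite I" "I \<noteq> {}" "\<And>i. i \<in> I \<Longrightarrow> b i \<ge> 1" "sum b I \<ge> 2"
    and X: "\<And>i. i \<in> I \<Longrightarrow> filterlim (X i) at_top sequentially"
  shows "(\<lambda>N. real (card {l \<in> (\<Pi>\<^sub>E i\<in>I. {1..X i N}). \<forall>d. (\<forall>i\<in>I. d ^ b i dvd l i) \<longrightarrow> d = 1}) /
                real (\<Prod>i\<in>I. X i N))
           \<longlonglongrightarrow> 1 / (\<Sum>n. 1 / real (Suc n) ^ sum b I)"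
proof -
  have eq_one_divide: "x * y = 1 \<Longrightarrow> x = 1 / y" for x y :: real
    by (cases "y = 0") (simp_all add: eq_divide_eq)
  define f where "f d N = moebius_mu (Suc d) * (\<Prod>i\<in>I. real (X i N div Suc d ^ b i) / real (X i N))"
    for d N
  have f_eq: "f d N = moebius_mu (Suc d) * real (\<Prod>i\<in>I. X i N div Suc d ^ b i) / real (\<Prod>i\<in>I. X i N)"
    for d N
    by (simp add: f_def prod_dividef)
  have prod_eq: "(\<Prod>i\<in>I. 1 / real (Suc d ^ b i)) = 1 / real (Suc d) ^ sum b I" for d
    by (simp add: prod_dividef power_sum del: of_nat_Suc)
  have lim: "f d \<longlonglongrightarrow> moebius_mu (Suc d) / real (Suc d) ^ sum b I" for d
  proof -
    have "f d \<longlonglongrightarrow> moebius_mu (Suc d) * (\<Prod>i\<in>I. 1 / real (Suc d ^ b i))"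
      unfolding f_def
      by (intro tendsto_mult tendsto_const tendsto_prod filterlim_compose[OF div_over_tendsto X]) auto
    then show ?thesis
      unfolding prod_eq by simp
  qed
  have bound: "norm (f d N) \<le> 1 / real (Suc d) ^ sum b I" for d N
  proof -
    have "norm (f d N) = \<bar>moebius_mu (Suc d)\<bar> * (\<Prod>i\<in>I. real (X i N div Suc d ^ b i) / real (X i N))"
      unfolding f_def by (simp add: abs_mult abs_prod)
    also have "\<dots> \<le> 1 * (\<Prod>i\<in>I. 1 / real (Suc d ^ b i))"
      using div_over_le
      by (intro mult_mono abs_moebius_le prod_mono prod_nonneg conjI) (auto simp del: of_nat_power)
    finally show ?thesis
      unfolding prod_eq by simp
  qed
  have "(\<lambda>N. suminf (\<lambda>d. f d N)) \<longlonglongrightarrow> (\<Sum>d. moebius_mu (Suc d) / real (Suc d) ^ sum b I)"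
    using tannerys_theorem[OF lim _ summable_inverse_Suc_power[OF assms(4)] sequentially_bot]
      bound by (simp add: case_prod_unfold)
  moreover have "suminf (\<lambda>d. f d N) =
      real (card {l \<in> (\<Pi>\<^sub>E i\<in>I. {1..X i N}). \<forall>d. (\<forall>i\<in>I. d ^ b i dvd l i) \<longrightarrow> d = 1}) /
        real (\<Prod>i\<in>I. X i N)" for N
    unfolding f_eq
    by (rule sums_unique[OF sums_divide[OF card_power_free_box[OF assms(1-3)]], symmetric])
  moreover have "(\<Sum>d. moebius_mu (Suc d) / real (Suc d) ^ sum b I) = 1 / (\<Sum>n. 1 / real (Suc n) ^ sum b I)"
    by (rule eq_one_divide[OF moebius_mu_series_times_zeta[OF assms(4)]])
  ultimately show ?thesis
    by simp
qed

section \<open>Rational powers and the arithmetic description of visibility\<close>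

lemma powr_of_int_mult_in_Rats:
  assumes "(t::real) > 0" "t powr e \<in> \<rat>"
  shows "t powr (of_int m * e) \<in> \<rat>"
proof -
  have "t powr (of_int m * e) = (t powr e) powr of_int m"
    by (simp add: powr_powr mult.commute)
  then show ?thesis
    using assms by (simp add: powr_real_of_int)
qed

lemma powr_int_combination_in_Rats:
  assumes "(t::real) > 0" "t powr e \<in> \<rat>" "t powr f \<in> \<rat>"
  shows "t powr (of_int m * e + of_int n * f) \<in> \<rat>"
  using assms by (simp add: powr_add powr_of_int_mult_in_Rats)

text \<open>Dividing a Bezout identity u x + v y = gcd x y by x y = gcd x y * lcm x y writes 1 / lcm
  x y as v / x + u / y, an integer combination of admissible exponents.\<close>

lemma powr_inverse_Lcm_in_Rats:
  fixes a :: "nat \<Rightarrow> nat"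
  assumes "finite I" "(t::real) > 0" "t \<in> \<rat>"
    and "\<And>i. i \<in> I \<Longrightarrow> a i \<ge> 1" "\<And>i. i \<in> I \<Longrightarrow> t powr (1 / real (a i)) \<in> \<rat>"
  shows "t powr (1 / real (Lcm (a ` I))) \<in> \<rat>"
  using assms(1,4,5)
proof (induction I)
  \<comment> \<open>The empty Lcm is 1, so the claim is the rationality of t itself.\<close>
  case empty
  then show ?case
    using assms(2,3) by simp
next
  case (insert j I)
  define x where "x = a j"
  define y where "y = Lcm (a ` I)"
  have "0 \<notin> a ` insert j I"
    using insert.prems(1) by force
  then have pos: "x > 0" "y > 0"
    using insert.hyps(1) by (auto simp: x_def y_def Lcm_0_iff simp flip: neq0_conv)
  obtain u v where uv: "u * int x + v * int y = gcd (int x) (int y)"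
    using bezout_int by blast
  have "gcd x y * lcm x y = x * y"
    by (rule prod_gcd_lcm_nat[symmetric])
  then have "real (gcd x y) * real (lcm x y) = real x * real y"
    by (metis of_nat_mult)
  moreover have "real (gcd x y) = of_int (u * int x + v * int y)"
    unfolding uv by simp
  ultimately have "1 / real (lcm x y) = of_int v * (1 / real x) + of_int u * (1 / real y)"
    using pos by (simp add: field_simps)
  moreover have "t powr (of_int v * (1 / real x) + of_int u * (1 / real y)) \<in> \<rat>"
    using insert assms(2) by (intro powr_int_combination_in_Rats) (auto simp: x_def y_def)
  ultimately show ?case
    by (simp add: x_def y_def)
qed

text \<open>The equation is the integrality of l^c (p/q)^(b c) with denominators cleared. As q is
  coprime to p, \<open>(q ^ b) ^ c\<close> divides \<open>l ^ c\<close>, and c-th roots can be taken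
  in a divisibility.\<close>

lemma power_root_dvd:
  fixes l p q r b c :: nat
  assumes "coprime p q" "c > 0" "l ^ c * p ^ (b * c) = r * q ^ (b * c)"
  shows "q ^ b dvd l"
proof -
  have "(q ^ b) ^ c dvd l ^ c * p ^ (b * c)"
    unfolding assms(3) by (simp add: power_mult)
  moreover have "coprime ((q ^ b) ^ c) (p ^ (b * c))"
    using assms(1) by (simp add: coprime_commute)
  ultimately show ?thesis
    using assms(2) by (simp add: coprime_dvd_mult_left_iff)
qed

lemma visible_power_point_iff:
  fixes a b l :: "nat \<Rightarrow> nat"
  assumes a: "\<And>i. i \<in> {1..k} \<Longrightarrow> a i \<ge> 1"
    and cop: "\<And>i. i \<in> {1..k} \<Longrightarrow> coprime (b i) (a i)"
    and comb: "\<exists>m :: nat \<Rightarrow> int. (\<Sum>i=1..k. of_int (m i) * (of_nat (b i) / of_nat (a i) :: rat)) = 1"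
    and alpha: "\<alpha> = Lcm (a ` {1..k})"
    and l: "\<And>i. i \<in> {1..k} \<Longrightarrow> l i \<ge> 1"
    and n: "\<And>i. i \<in> {1..k} \<Longrightarrow> n i = l i ^ (\<alpha> div a i)"
  shows "visible k (\<lambda>i. of_nat (b i) / of_nat (a i)) n \<longleftrightarrow>
           (\<forall>d. (\<forall>i\<in>{1..k}. d ^ b i dvd l i) \<longrightarrow> d = 1)"
proof -
  define c where "c i = \<alpha> div a i" for i
  have alpha_pos: "\<alpha> > 0"
    using a unfolding alpha by (force intro!: gr0I simp: Lcm_0_iff)
  have ac: "\<alpha> = a i * c i" if "i \<in> {1..k}" for i
    using that unfolding c_def alpha by (simp add: dvd_Lcm)
  have c_pos: "c i > 0" if "i \<in> {1..k}" for i
    using ac[OF that] alpha_pos by (auto intro!: gr0I)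
  have ab: "real_of_rat (of_nat (b i) / of_nat (a i)) = real (b i) / real (a i)" for i
    by (simp add: of_rat_divide)
  \<comment> \<open>Since \<open>\<alpha> = a i * c i\<close>, all the powers of t in question are
    integer powers of the single root t^(1/\<alpha>).\<close>
  have powr_root: "t powr (real (b i) / real (a i)) = (t powr (1 / real \<alpha>)) ^ (b i * c i)"
    if "i \<in> {1..k}" "t > 0" for i t
  proof -
    have "(t powr (1 / real \<alpha>)) ^ (b i * c i) = t powr (1 / real \<alpha> * real (b i * c i))"
      using that(2) by (simp add: powr_powr flip: powr_realpow)
    also have "1 / real \<alpha> * real (b i * c i) = real (b i) / real (a i)"
      using that(1) a[of i] c_pos[of i] unfolding ac[OF that(1)] by (simp add: field_simps)
    finally show ?thesis ..
  qed
  have npos: "n i > 0" if "i \<in> {1..k}" for i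
    using n[OF that] l[OF that] by simp
  show ?thesis
  proof (intro iffI allI impI)
    assume vis: "visible k (\<lambda>i. of_nat (b i) / of_nat (a i)) n"
    fix d assume d: "\<forall>i\<in>{1..k}. d ^ b i dvd l i"
    obtain m :: "nat \<Rightarrow> int"
      where m: "(\<Sum>i=1..k. of_int (m i) * (of_nat (b i) / of_nat (a i) :: rat)) = 1"
      using comb by blast
    \<comment> \<open>An index with positive exponent is what excludes d = 0, because
      \<open>0 ^ 0 = 1\<close> divides everything. Were all exponents 0, the combination would be 0
      instead of 1.\<close>
    obtain j where j: "j \<in> {1..k}" "b j > 0"
    proof -
      have "\<exists>j\<in>{1..k}. b j \<noteq> 0"
      proof (rule ccontr)
        assume "\<not> (\<exists>j\<in>{1..k}. b j \<noteq> 0)"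
        then have "(\<Sum>i=1..k. of_int (m i) * (of_nat (b i) / of_nat (a i) :: rat)) = 0"
          by (intro sum.neutral) simp
        then show False
          using m by simp
      qed
      then show ?thesis
        using that by auto
    qed
    have "d \<noteq> 0"
      using d j l[OF j(1)] by (metis dvd_0_left_iff not_one_le_zero power_0_left zero_less_iff_neq_zero)
    show "d = 1"
    proof (rule ccontr)
      assume "d \<noteq> 1"
      \<comment> \<open>Chosen so that t^(1/\<alpha>) = 1/d; it lies below 1 because d is at least
        2.\<close>
      define t where "t = real d powr - real \<alpha>"
      have "0 < t"
        using \<open>d \<noteq> 0\<close> by (simp add: t_def)
      moreover have "t < 1"
        using \<open>d \<noteq> 0\<close> \<open>d \<noteq> 1\<close> alpha_pos powr_less_mono2_neg[of "- real \<alpha>" 1 "real d"]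
        by (simp add: t_def)
      moreover have "real (n i) * t powr real_of_rat (of_nat (b i) / of_nat (a i)) \<in> \<nat> - {0}"
        if i: "i \<in> {1..k}" for i
      proof -
        obtain e where e: "l i = d ^ b i * e"
          using d i by blast
        have "t powr (1 / real \<alpha>) = 1 / real d"
          unfolding t_def powr_powr using alpha_pos by (simp add: powr_minus_divide)
        \<comment> \<open>The factor d^(b i * c i) of \<open>n i = (d ^ b i * e) ^ c i\<close>
          cancels against the power of t.\<close>
        then have "real (n i) * t powr (real (b i) / real (a i)) = real (e ^ c i)"
          using \<open>d \<noteq> 0\<close> \<open>0 < t\<close> n[OF i] by (simp add: powr_root[OF i] e c_def[symmetric] power_mult
              power_mult_distrib power_divide)
        moreover have "e \<noteq> 0"
          using e l[OF i] by auto
        ultimately show ?thesis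
          unfolding ab by (simp del: of_nat_power)
      qed
      ultimately show False
        using vis unfolding visible_def by blast
    qed
  next
    assume free: "\<forall>d. (\<forall>i\<in>{1..k}. d ^ b i dvd l i) \<longrightarrow> d = 1"
    show "visible k (\<lambda>i. of_nat (b i) / of_nat (a i)) n"
      unfolding visible_def
    proof (rule notI, elim exE conjE)
      fix t :: real
      assume t: "0 < t" "t < 1"
        and "\<forall>i\<in>{1..k}. real (n i) * t powr real_of_rat (of_nat (b i) / of_nat (a i)) \<in> \<nat> - {0}"
      then have "\<forall>i\<in>{1..k}. \<exists>r. real (n i) * t powr (real (b i) / real (a i)) = real r"
        unfolding ab by (auto elim!: Nats_cases)
      then obtain r where r: "\<And>i. i \<in> {1..k} \<Longrightarrow>
          real (n i) * t powr (real (b i) / real (a i)) = real (r i)"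
        by metis
      have ratio: "t powr (real (b i) / real (a i)) \<in> \<rat>" if "i \<in> {1..k}" for i
      proof -
        have "t powr (real (b i) / real (a i)) = real (r i) / real (n i)"
          using r[OF that] npos[OF that] by (simp add: field_simps)
        then show ?thesis
          by simp
      qed
      obtain m :: "nat \<Rightarrow> int"
        where "(\<Sum>i=1..k. of_int (m i) * (of_nat (b i) / of_nat (a i) :: rat)) = 1"
        using comb by blast
      then have "real_of_rat (\<Sum>i=1..k. of_int (m i) * (of_nat (b i) / of_nat (a i))) = 1"
        by simp
      then have m: "(\<Sum>i=1..k. of_int (m i) * (real (b i) / real (a i))) = 1"
        by (simp add: of_rat_sum of_rat_mult of_rat_divide)
      \<comment> \<open>The exponent equals 1 by the gcd hypothesis, while the power splits into a
        product of integer powers of rationals; hence t is rational.\<close>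
      have "t powr (\<Sum>i=1..k. of_int (m i) * (real (b i) / real (a i))) \<in> \<rat>"
        using t ratio
        by (subst powr_sum) (auto simp del: times_divide_eq_right intro!: Rats_prod powr_of_int_mult_in_Rats)
      then have t_rat: "t \<in> \<rat>"
        unfolding m using t by simp
      \<comment> \<open>Bezout for the coprime pair \<open>b i\<close>, \<open>a i\<close>, divided
        by \<open>a i\<close>, expresses 1 / \<open>a i\<close> through the exponents
        \<open>b i / a i\<close> and 1, both known to give rational powers.\<close>
      have "t powr (1 / real (a i)) \<in> \<rat>" if i: "i \<in> {1..k}" for i
      proof -
        obtain u v where uv: "u * int (b i) + v * int (a i) = gcd (int (b i)) (int (a i))"
          using bezout_int by blast
        have "of_int (u * int (b i) + v * int (a i)) = (1::real)"
          unfolding uv using cop[OF i] by (simp add: coprime_iff_gcd_eq_1)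
        then have "1 / real (a i) = of_int u * (real (b i) / real (a i)) + of_int v * 1"
          using a[OF i] by (simp add: field_simps)
        then show ?thesis
          using powr_int_combination_in_Rats[OF t(1) ratio[OF i], of 1 u v] t t_rat by simp
      qed
      then have "t powr (1 / real \<alpha>) \<in> \<rat>"
        unfolding alpha using t t_rat a by (intro powr_inverse_Lcm_in_Rats) auto
      then obtain p q :: nat where pq: "q \<noteq> 0" "\<bar>t powr (1 / real \<alpha>)\<bar> = real p / real q" "coprime p q"
        by (rule Rats_abs_nat_div_natE)
      then have root: "t powr (1 / real \<alpha>) = real p / real q"
        by simp
      have "t powr (1 / real \<alpha>) < 1" "t powr (1 / real \<alpha>) > 0"
        using t alpha_pos powr_less_mono2[of "1 / real \<alpha>" t 1] by simp_all
      \<comment> \<open>A root strictly between 0 and 1 has denominator q > 1, so q is the forbidden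
        common power divisor.\<close>
      then have "0 < p" "p < q"
        using pq(1) unfolding root by (auto simp: field_simps zero_less_divide_iff)
      then have "q \<noteq> 1"
        by simp
      moreover have "q ^ b i dvd l i" if i: "i \<in> {1..k}" for i
      proof (rule power_root_dvd[OF pq(3) c_pos[OF i]])
        have "real (l i ^ c i) * (real p / real q) ^ (b i * c i) = real (r i)"
          using r[OF i] n[OF i] t unfolding powr_root[OF i t(1)] root c_def by simp
        then have "real (l i ^ c i * p ^ (b i * c i)) = real (r i * q ^ (b i * c i))"
          using pq(1) by (simp add: field_simps power_divide)
        then show "l i ^ c i * p ^ (b i * c i) = r i * q ^ (b i * c i)"
          using of_nat_eq_iff by blast
      qed
      ultimately show False
        using free by blast
    qed
  qed
qed

section \<open>The case of the divergent zeta series\<close>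

text \<open>As \<open>l j\<close> divides itself, only the point with \<open>l j = 1\<close>
  survives, and one point has density 0 in a growing box.\<close>

lemma density_power_free_singleton:
  fixes X :: "'a \<Rightarrow> nat \<Rightarrow> nat"
  assumes "filterlim (X j) at_top sequentially"
  shows "(\<lambda>N. real (card {l \<in> (\<Pi>\<^sub>E i\<in>{j}. {1..X i N}). \<forall>d. d dvd l j \<longrightarrow> d = 1}) / real (X j N))
           \<longlonglongrightarrow> 0"
proof (rule tendsto_sandwich[where f = "\<lambda>_. 0" and h = "\<lambda>N. 1 / real (X j N)"])
  let ?F = "\<lambda>N. {l \<in> (\<Pi>\<^sub>E i\<in>{j}. {1..X i N}). \<forall>d. d dvd l j \<longrightarrow> d = 1}"
  have "(\<lambda>n. 1 / real n) \<longlonglongrightarrow> 0"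
    by (rule lim_1_over_n)
  then show "(\<lambda>N. 1 / real (X j N)) \<longlonglongrightarrow> 0"
    using assms by (rule filterlim_compose)
  have "real (card (?F N)) \<le> 1" for N
  proof -
    have "l = (\<lambda>i\<in>{j}. 1)" if "l \<in> ?F N" for l
    proof -
      have "\<forall>d. d dvd l j \<longrightarrow> d = 1"
        using that by blast
      then have "l j = 1"
        by simp
      then show ?thesis
        using that by (auto simp: PiE_iff extensional_def restrict_def)
    qed
    then have "?F N \<subseteq> {\<lambda>i\<in>{j}. 1}"
      by blast
    from card_mono[OF _ this] show ?thesis
      by simp
  qed
  then have "real (card (?F N)) / real (X j N) \<le> 1 / real (X j N)" for N
    by (rule divide_right_mono) simp
  then show "\<forall>\<^sub>F N in sequentially. real (card (?F N)) / real (X j N) \<le> 1 / real (X j N)"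
    by (intro always_eventually allI)
qed simp_all

section \<open>Change of variables from perfect powers to their roots\<close>

lemma power_le_iff_le_nth_root_nat:
  assumes "c > 0"
  shows "x ^ c \<le> N \<longleftrightarrow> x \<le> nth_root_nat c N"
proof
  show "x \<le> nth_root_nat c N" if "x ^ c \<le> N"
    using nth_root_nat_mono[OF that, of c] assms by simp
  show "x ^ c \<le> N" if "x \<le> nth_root_nat c N"
    using power_mono[OF that, of c] nth_root_nat_power_le[OF assms, of N] by simp
qed

text \<open>The root reaches a given x as soon as N reaches x^c.\<close>

lemma filterlim_nth_root_nat:
  assumes "c > 0"
  shows "filterlim (nth_root_nat c) at_top sequentially"
  unfolding filterlim_at_top eventually_sequentially
  using power_le_iff_le_nth_root_nat[OF assms] by blast

text \<open>Taking roots coordinatewise turns the sampled points into a full box. Its sides grow at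
  different rates when the \<open>c i\<close> differ, which is why the density results allow a
  separate side for each coordinate.\<close>

lemma nth_powers_box_eq:
  fixes c :: "nat \<Rightarrow> nat"
  assumes "\<And>i. i \<in> I \<Longrightarrow> c i > 0"
  shows "(\<Pi>\<^sub>E i\<in>I. nth_powers (c i)) \<inter> (I \<rightarrow>\<^sub>E {1..N}) =
           (\<lambda>l. \<lambda>i\<in>I. l i ^ c i) ` (\<Pi>\<^sub>E i\<in>I. {1..nth_root_nat (c i) N})"
proof (intro equalityI subsetI)
  fix n assume n: "n \<in> (\<Pi>\<^sub>E i\<in>I. nth_powers (c i)) \<inter> (I \<rightarrow>\<^sub>E {1..N})"
  then have "\<forall>i\<in>I. \<exists>l. l \<ge> 1 \<and> n i = l ^ c i"
    by (auto simp: PiE_iff nth_powers_def)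
  then obtain l where l: "\<And>i. i \<in> I \<Longrightarrow> l i \<ge> 1 \<and> n i = l i ^ c i"
    by metis
  \<comment> \<open>The chosen roots are arbitrary outside I; restriction makes them an extensional
    function.\<close>
  have "restrict l I \<in> (\<Pi>\<^sub>E i\<in>I. {1..nth_root_nat (c i) N})"
    using n l assms by (auto simp: PiE_iff simp flip: power_le_iff_le_nth_root_nat)
  moreover have "n = (\<lambda>i\<in>I. restrict l I i ^ c i)"
    using n l by (auto simp: PiE_iff extensional_def restrict_def fun_eq_iff)
  ultimately show "n \<in> (\<lambda>l. \<lambda>i\<in>I. l i ^ c i) ` (\<Pi>\<^sub>E i\<in>I. {1..nth_root_nat (c i) N})"
    by blast
next
  fix n assume "n \<in> (\<lambda>l. \<lambda>i\<in>I. l i ^ c i) ` (\<Pi>\<^sub>E i\<in>I. {1..nth_root_nat (c i) N})"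
  then show "n \<in> (\<Pi>\<^sub>E i\<in>I. nth_powers (c i)) \<inter> (I \<rightarrow>\<^sub>E {1..N})"
    using assms by (auto simp: nth_powers_def PiE_iff power_le_iff_le_nth_root_nat)
qed

lemma inj_on_power_box:
  fixes c X :: "nat \<Rightarrow> nat"
  assumes "\<And>i. i \<in> I \<Longrightarrow> c i > 0"
  shows "inj_on (\<lambda>l. \<lambda>i\<in>I. l i ^ c i) (\<Pi>\<^sub>E i\<in>I. {1..X i})"
proof (rule inj_onI)
  fix l m
  assume lm: "l \<in> (\<Pi>\<^sub>E i\<in>I. {1..X i})" "m \<in> (\<Pi>\<^sub>E i\<in>I. {1..X i})"
    and eq: "(\<lambda>i\<in>I. l i ^ c i) = (\<lambda>i\<in>I. m i ^ c i)"
  show "l = m"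
  proof (rule PiE_ext[OF lm])
    fix i assume i: "i \<in> I"
    then have "l i ^ c i = m i ^ c i"
      using fun_cong[OF eq, of i] by simp
    then show "l i = m i"
      using assms[OF i] by (simp add: power_eq_iff_eq_base)
  qed
qed

section \<open>Evaluating the proportion\<close>

text \<open>The series converges to a positive real, so division in \<open>ennreal\<close> agrees
  with real division.\<close>

lemma enn2real_inverse_zeta:
  assumes "s \<ge> 2"
  shows "enn2real (1 / zeta (real s)) = 1 / (\<Sum>n. 1 / real (Suc n) ^ s)"
proof -
  have "zeta (real s) = ennreal (\<Sum>n. 1 / real (Suc n) ^ s)"
    using assms by (simp add: zeta_eq_real_series powr_realpow del: of_nat_Suc)
  moreover have "(\<Sum>n. 1 / real (Suc n) ^ s) > 0"
    using summable_inverse_Suc_power[OF assms] by (intro suminf_pos) simp_all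
  ultimately show ?thesis
    by (simp add: divide_ennreal flip: ennreal_1)
qed

theorem theorem2:
  fixes k :: nat and a b :: "nat \<Rightarrow> nat" and \<alpha> :: nat
  assumes "k \<ge> 1"
    and "\<And>i. i \<in> {1..k} \<Longrightarrow> a i \<ge> 1"
    and "\<And>i. i \<in> {1..k} \<Longrightarrow> b i \<ge> 1"
    and "\<And>i. i \<in> {1..k} \<Longrightarrow> coprime (b i) (a i)"
    and "\<exists>m :: nat \<Rightarrow> int. (\<Sum>i=1..k. of_int (m i) * (of_nat (b i) / of_nat (a i) :: rat)) = 1"
    and "\<alpha> = Lcm (a ` {1..k})"
  shows "has_proportion k
           (\<Pi>\<^sub>E i\<in>{1..k}. nth_powers (\<alpha> div a i))
           (visible k (\<lambda>i. of_nat (b i) / of_nat (a i)))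
           (enn2real (1 / zeta (real (\<Sum>i=1..k. b i))))"
proof -
  define I where "I = {1..k}"
  define X where "X i N = nth_root_nat (\<alpha> div a i) N" for i N
  define power where "power l = (\<lambda>i\<in>I. l i ^ (\<alpha> div a i))" for l :: "nat \<Rightarrow> nat"
  let ?S = "\<Pi>\<^sub>E i\<in>I. nth_powers (\<alpha> div a i)"
  let ?vis = "visible k (\<lambda>i. of_nat (b i) / of_nat (a i))"
  let ?B = "\<lambda>N. \<Pi>\<^sub>E i\<in>I. {1..X i N}"
  let ?free = "\<lambda>l. \<forall>d. (\<forall>i\<in>I. d ^ b i dvd l i) \<longrightarrow> d = 1"
  have "\<alpha> > 0"
    using assms(2) unfolding assms(6) by (force intro!: gr0I simp: Lcm_0_iff)
  have c_pos: "\<alpha> div a i > 0" if "i \<in> I" for i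
  proof -
    have "a i dvd \<alpha>"
      using that unfolding assms(6) I_def by (simp add: dvd_Lcm)
    then show ?thesis
      using \<open>\<alpha> > 0\<close> by (auto simp: dvd_div_eq_0_iff intro!: gr0I)
  qed
  have box: "?S \<inter> (I \<rightarrow>\<^sub>E {1..N}) = power ` ?B N" for N
    unfolding power_def X_def using c_pos by (rule nth_powers_box_eq)
  have inj: "inj_on power (?B N)" for N
    unfolding power_def using c_pos by (rule inj_on_power_box)
  \<comment> \<open>Visibility of a point is translated into power-freeness of its roots; with
    injectivity of \<open>power\<close>, the visible points and the power-free tuples are equally
    many.\<close>
  have vis: "?vis (power l) \<longleftrightarrow> ?free l" if "l \<in> ?B N" for l N
    unfolding I_def
    using that by (intro visible_power_point_iff[OF assms(2,4,5,6)]) (auto simp: PiE_iff I_def power_def)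
  have "{n \<in> ?S \<inter> (I \<rightarrow>\<^sub>E {1..N}). ?vis n} = power ` {l \<in> ?B N. ?free l}" for N
    unfolding box using vis by blast
  then have count: "card {n \<in> ?S \<inter> (I \<rightarrow>\<^sub>E {1..N}). ?vis n} = card {l \<in> ?B N. ?free l}" for N
    using inj[of N] by (simp add: card_image inj_on_subset)
  have total: "card (?S \<inter> (I \<rightarrow>\<^sub>E {1..N})) = (\<Prod>i\<in>I. X i N)" for N
    unfolding box card_image[OF inj] by (simp add: card_PiE I_def)
  have X: "filterlim (X i) at_top sequentially" if "i \<in> I" for i
    unfolding X_def using c_pos[OF that] by (rule filterlim_nth_root_nat)
  have "(\<lambda>N. real (card {l \<in> ?B N. ?free l}) / real (\<Prod>i\<in>I. X i N))
          \<longlonglongrightarrow> enn2real (1 / zeta (real (sum b I)))"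
  proof (cases "sum b I \<ge> 2")
    case True
    have "(\<lambda>N. real (card {l \<in> ?B N. ?free l}) / real (\<Prod>i\<in>I. X i N))
            \<longlonglongrightarrow> 1 / (\<Sum>n. 1 / real (Suc n) ^ sum b I)"
      using assms(1,3) True X by (intro density_power_free_box) (auto simp: I_def)
    then show ?thesis
      unfolding enn2real_inverse_zeta[OF True] .
  next
    case False
    \<comment> \<open>Every \<open>b i\<close> is at least 1, so a sum below 2 leaves only k = 1 and
      \<open>b 1 = 1\<close>. There \<open>zeta 1\<close> is infinite and its reciprocal in
      \<open>ennreal\<close> is 0, the limit of the singleton count.\<close>
    have "k \<le> sum b I"
      using sum_mono[of I "\<lambda>_. 1" b] assms(3) by (simp add: I_def)
    then have "k = 1" "sum b I = 1"
      using assms(1) False by linarith+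
    then have I: "I = {1}" and "b 1 = 1"
      by (auto simp: I_def)
    then show ?thesis
      using density_power_free_singleton[of X 1] X[of 1] by (simp add: zeta_1)
  qed
  then show ?thesis
    unfolding has_proportion_def count[unfolded I_def] total[unfolded I_def]
    by (simp add: I_def)
qed

end
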